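(* For a positive integer $N$ let $$g(N):=\max\{|A|: A\subseteq[N]^2,\ \text{no positive distance is determined twice by }A\}.$$ There is an absolute constant $c>0$ such that, for all $N\ge3$, $$g(N)\ll N\exp\left(-c\,\frac{\log N}{\log\log N}\right).$$
   Context: $[N]^2=\{1,\ldots,N\}\times\{1,\ldots,N\}$. "No positive distance is determined twice by $A$" means that no two distinct unordered pairs of distinct points of $A$ have the same Euclidean distance. $X\ll Y$ means $X\le CY$ for an absolute constant $C>0$. *)

theory Defs
  imports "HOL-Analysis.Analysis"
begin

(* The metric on real * real is the Euclidean one (Product_Vector), so dist below
   is the Euclidean distance in the plane. *)

definition grid :: "nat \<Rightarrow> (real \<times> real) set" where
  "grid N = real ` {1..N} \<times> real ` {1..N}"

definition no_distance_twice :: "'a::metric_space set \<Rightarrow> bool" where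
  "no_distance_twice A \<longleftrightarrow>
     (\<forall>p\<in>A. \<forall>q\<in>A. \<forall>r\<in>A. \<forall>s\<in>A.
        p \<noteq> q \<longrightarrow> r \<noteq> s \<longrightarrow> {p, q} \<noteq> {r, s} \<longrightarrow> dist p q \<noteq> dist r s)"

definition g :: "nat \<Rightarrow> nat" where
  "g N = Max {card A | A. A \<subseteq> grid N \<and> no_distance_twice A}"

lemma finite_grid: "finite (grid N)"
  by (simp add: grid_def)

(* The maximum defining g is over a finite nonempty set, hence attained. *)

lemma g_attained: "g N \<in> {card A | A. A \<subseteq> grid N \<and> no_distance_twice A}"
proof -
  have "finite {card A | A. A \<subseteq> grid N \<and> no_distance_twice A}"
    by (rule finite_subset[of _ "card ` Pow (grid N)"]) (auto simp: finite_grid)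
  moreover have "card ({} :: (real \<times> real) set)
      \<in> {card A | A. A \<subseteq> grid N \<and> no_distance_twice A}"
    by (intro CollectI exI[of _ "{}"]) (simp add: no_distance_twice_def)
  ultimately show ?thesis
    unfolding g_def by (intro Max_in) auto
qed

end

theory Submission
  imports Defs "HOL-Computational_Algebra.Primes"
begin

text \<open>
  A distance whose square has many representations as a sum of two squares is realised by many
  vectors, but a set without repeated distances contains a pair for at most one of them. The proof
  turns this waste into a saving of size exponential in \<open>k\<close>, the number of prime factors that
  can be packed into a modulus below \<open>sqrt N\<close>; this \<open>k\<close> has order \<open>log N / log log N\<close>.

  Take \<open>k\<close> odd primes \<open>p\<close> for which \<open>-1\<close> is a square modulo \<open>p\<close>, say \<open>r p\<close> is a
  square root, and let \<open>m\<close> be their product. Every choice of signs for the roots gives a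
  lattice of vectors \<open>(a, b)\<close> with \<open>a\<close> congruent to \<open>\<plusminus>r p * b\<close> modulo each \<open>p\<close>. It has index
  \<open>m\<close> and all its vectors have squared length divisible by \<open>m\<close>. (In the Gaussian integers
  these are the \<open>2^k\<close> ideals of norm \<open>m\<close> obtained by choosing one of the two conjugate prime
  factors of each \<open>p\<close>.) By Cauchy-Schwarz, each lattice contains the difference of at
  least \<open>|A|^2 / m\<close> ordered pairs of points of \<open>A\<close>, hence
  \<open>2^k * |A|^2 / m\<close> pairs are found when all lattices are used
  (lemma \<open>card_squared_le_lattice_pairs\<close>). On the other hand, the pairs of equal points
  contribute \<open>2^k * |A|\<close>. The squared length of any other pair is one of the
  at most \<open>2 * N^2 / m\<close> multiples of \<open>m\<close> up to \<open>2 * N^2\<close>, and each of these occurs for at most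
  one pair of points, counted twice. A vector lies in several lattices only if its squared length
  is divisible by further factors \<open>p\<close> (lemma \<open>card_lattices_containing_le\<close>), so that summing the
  multiplicities costs only a factor \<open>(4/3)^k\<close>. The gain of \<open>2^k\<close> against a loss of
  \<open>(4/3)^k\<close> gives \<open>|A| \<le> m + 2 * N * (2/3)^(k/2)\<close>
  (\<open>card_le_of_norm_determines_pair\<close>).

  The primes must be as small as a fixed power of \<open>k\<close>, so that \<open>k\<close> of order \<open>log N / log log N\<close> is
  compatible with \<open>m \<le> sqrt N\<close>. They are found among the prime factors of the numbers \<open>n^2 + 1\<close> with
  \<open>n \<le> X\<close>. The product of these numbers exceeds \<open>(X!)^2\<close>, whose logarithm
  is about \<open>2 * X * log X\<close>, whereas an odd prime \<open>p\<close> contributes only \<open>O(X * log p / p)\<close> to it, apart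
  from an error of \<open>O(log X)\<close>. Since the sum of \<open>log p / p\<close> over all primes \<open>p \<le> Y\<close> is
  \<open>O(log Y)\<close>, the primes up to a small power \<open>Y\<close> of \<open>X\<close> cannot account for
  the product, and the larger ones can do so only if there are at least of the order of \<open>Y\<close> of them
  (\<open>many_primes_dividing_squares_plus_one\<close>).
\<close>

section \<open>Logarithms of prime divisors\<close>

lemma prime_gt_1_real: "prime (p::nat) \<Longrightarrow> real p > 1"
  using prime_gt_1_nat[of p] by simp

lemma ln_prime_ge_0: "prime (p::nat) \<Longrightarrow> 0 \<le> ln (real p)"
  using prime_gt_1_real[of p] by simp

lemma ln_eq_sum_multiplicity:
  fixes m :: nat
  assumes "m > 0"
  shows "ln (real m) = (\<Sum>p\<in>prime_factors m. real (multiplicity p m) * ln (real p))"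
proof -
  have "real m = (\<Prod>p\<in>prime_factors m. real p ^ multiplicity p m)"
    by (subst (1) prime_factorization_nat[OF assms]) simp
  also have "ln \<dots> = (\<Sum>p\<in>prime_factors m. ln (real p ^ multiplicity p m))"
    by (intro ln_prod) (auto simp: in_prime_factors_iff prime_gt_0_nat)
  also have "\<dots> = (\<Sum>p\<in>prime_factors m. real (multiplicity p m) * ln (real p))"
    by (intro sum.cong refl) (auto simp: ln_realpow in_prime_factors_iff prime_gt_0_nat)
  finally show ?thesis .
qed

lemma sum_ln_prime_divisors_le:
  fixes n :: nat
  assumes "n > 0"
  shows "(\<Sum>p | prime p \<and> p dvd n. ln (real p)) \<le> ln (real n)"
proof -
  have "{p. prime p \<and> p dvd n} = prime_factors n"
    using assms by (auto simp: in_prime_factors_iff)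
  moreover have "ln (real p) \<le> real (multiplicity p n) * ln (real p)"
    if "p \<in> prime_factors n" for p
  proof -
    have "multiplicity p n \<ge> 1"
      using that by (simp add: prime_factors_multiplicity Suc_leI)
    moreover have "ln (real p) \<ge> 0"
      using that by (simp add: in_prime_factors_iff prime_gt_0_nat Suc_leI)
    ultimately show ?thesis
      using mult_right_mono[of 1 "real (multiplicity p n)" "ln (real p)"] by simp
  qed
  ultimately show ?thesis
    by (simp add: ln_eq_sum_multiplicity[OF assms] sum_mono)
qed

lemma card_multiples_upto:
  assumes "q > (0::nat)"
  shows "card {n\<in>{1..X}. q dvd n} = X div q"
proof -
  have "{n\<in>{1..X}. q dvd n} = (\<lambda>t. q * t) ` {1..X div q}"
    using assms by (auto simp: less_eq_div_iff_mult_less_eq mult.commute elim!: dvdE)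
  moreover have "inj_on (\<lambda>t. q * t) {1..X div q}"
    using assms by (auto intro: inj_onI)
  ultimately show ?thesis
    by (simp add: card_image)
qed

text \<open>
  A one-sided and weak form of Mertens' first theorem. Counting the primes dividing the numbers up
  to \<open>Y\<close> bounds the sum of \<open>\<lfloor>Y / p\<rfloor> * ln p\<close> by \<open>ln (Y!)\<close>, and the rounding costs at most
  \<open>ln p\<close> for each of the at most \<open>Y\<close> primes. The constant 2 in place of 1 saves an appeal to
  Chebyshev's estimate for the number of primes.
\<close>
lemma sum_ln_over_primes_le:
  fixes Y :: nat
  assumes "Y \<ge> 1"
  shows "(\<Sum>p | prime p \<and> p \<le> Y. ln (real p) / real p) \<le> 2 * ln (real Y)"
proof -
  define Q where "Q = {p. prime p \<and> p \<le> Y}"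
  have fin: "finite Q" unfolding Q_def by (rule finite_subset[of _ "{..Y}"]) auto
  have cardQ: "card Q \<le> Y"
    using card_mono[of "{1..Y}" Q] prime_ge_1_nat by (auto simp: Q_def subset_iff)
  have lnQ: "0 \<le> ln (real p) \<and> ln (real p) \<le> ln (real Y)" if "p \<in> Q" for p
    using that prime_ge_1_nat[of p] by (auto simp: Q_def)
  have "(\<Sum>p\<in>Q. (real Y / real p - 1) * ln (real p)) \<le> (\<Sum>p\<in>Q. real (Y div p) * ln (real p))"
  proof (intro sum_mono mult_right_mono)
    fix p assume "p \<in> Q"
    have "real (Y div p) = of_int \<lfloor>real Y / real p\<rfloor>"
      by (simp add: floor_divide_of_nat_eq)
    then show "real Y / real p - 1 \<le> real (Y div p)"
      by linarith
  qed (use lnQ in auto)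
  also have "\<dots> = (\<Sum>p\<in>Q. \<Sum>n\<in>{n\<in>{1..Y}. p dvd n}. ln (real p))"
  proof (intro sum.cong refl)
    fix p assume "p \<in> Q"
    then have "p > 0" by (auto simp: Q_def prime_gt_0_nat)
    then show "real (Y div p) * ln (real p) = (\<Sum>n\<in>{n\<in>{1..Y}. p dvd n}. ln (real p))"
      by (simp only: sum_constant card_multiples_upto)
  qed
  also have "\<dots> = (\<Sum>n\<in>{1..Y}. \<Sum>p\<in>{p\<in>Q. p dvd n}. ln (real p))"
    by (rule sum.swap_restrict) (use fin in auto)
  also have "\<dots> = (\<Sum>n\<in>{1..Y}. \<Sum>p | prime p \<and> p dvd n. ln (real p))"
  proof (intro sum.cong refl)
    fix n assume n: "n \<in> {1..Y}"
    have "p \<le> Y" if "p dvd n" for p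
      using dvd_imp_le[OF that] n by auto
    then show "{p\<in>Q. p dvd n} = {p. prime p \<and> p dvd n}"
      by (auto simp: Q_def)
  qed
  also have "\<dots> \<le> (\<Sum>n\<in>{1..Y}. ln (real n))"
    by (intro sum_mono sum_ln_prime_divisors_le) auto
  also have "\<dots> \<le> (\<Sum>n\<in>{1..Y}. ln (real Y))"
    by (intro sum_mono) auto
  finally have 1: "(\<Sum>p\<in>Q. (real Y / real p - 1) * ln (real p)) \<le> real Y * ln (real Y)"
    by simp
  have "(\<Sum>p\<in>Q. ln (real p)) \<le> real (card Q) * ln (real Y)"
    using sum_bounded_above[of Q "\<lambda>p. ln (real p)" "ln (real Y)"] lnQ by simp
  also have "\<dots> \<le> real Y * ln (real Y)"
    using cardQ assms by (intro mult_right_mono) auto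
  finally have 2: "(\<Sum>p\<in>Q. ln (real p)) \<le> real Y * ln (real Y)" .
  have "(\<Sum>p\<in>Q. (real Y / real p - 1) * ln (real p))
      = real Y * (\<Sum>p\<in>Q. ln (real p) / real p) - (\<Sum>p\<in>Q. ln (real p))"
    by (simp add: algebra_simps sum_subtractf sum_distrib_left)
  with 1 2 have "real Y * (\<Sum>p\<in>Q. ln (real p) / real p) \<le> real Y * (2 * ln (real Y))"
    by simp
  with assms show ?thesis
    unfolding Q_def by simp
qed

section \<open>Prime divisors of \<open>n\<^sup>2 + 1\<close>\<close>

lemma card_residue_class_upto:
  fixes q :: nat
  assumes "q > 0"
  shows "card {n\<in>{1..X}. n mod q = a} \<le> X div q + 1"
proof -
  have "inj_on (\<lambda>n. n div q) {n\<in>{1..X}. n mod q = a}"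
  proof (rule inj_onI)
    fix m n assume "m \<in> {n\<in>{1..X}. n mod q = a}" "n \<in> {n\<in>{1..X}. n mod q = a}" "m div q = n div q"
    then show "m = n" using div_mult_mod_eq[of m q] div_mult_mod_eq[of n q] by simp
  qed
  moreover have "(\<lambda>n. n div q) ` {n\<in>{1..X}. n mod q = a} \<subseteq> {0..X div q}"
    by (auto intro: div_le_mono)
  ultimately show ?thesis
    using card_inj_on_le[of "\<lambda>n. n div q" _ "{0..X div q}"] by simp
qed

text \<open>
  The prime power divides \<open>(n - m) * (n + m)\<close>. If \<open>p\<close> divided both factors, it would divide \<open>2 * m\<close>
  and hence \<open>m\<close>, which is impossible for a divisor of \<open>m\<^sup>2 + 1\<close>; so the whole prime power divides
  one of them.
\<close>
lemma sqrt_minus_one_unique_up_to_sign: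
  fixes p j :: nat and m n :: int
  assumes p: "prime p" "odd p"
    and m: "int p ^ j dvd m\<^sup>2 + 1" and n: "int p ^ j dvd n\<^sup>2 + 1"
  shows "int p ^ j dvd n - m \<or> int p ^ j dvd n + m"
proof (cases "j = 0")
  case False
  have pm: "int p dvd m\<^sup>2 + 1"
    using m False dvd_trans[OF dvd_power[of j "int p"]] by auto
  have "n\<^sup>2 + 1 - (m\<^sup>2 + 1) = (n - m) * (n + m)"
    by (simp add: algebra_simps power2_eq_square)
  then have d: "int p ^ j dvd (n - m) * (n + m)"
    using dvd_diff[OF n m] by simp
  have pp: "prime (int p)" using p by simp
  have "\<not> (int p dvd n - m \<and> int p dvd n + m)"
  proof
    assume "int p dvd n - m \<and> int p dvd n + m"
    then have "int p dvd (n + m) - (n - m)" by (metis dvd_diff)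
    then have "int p dvd 2 * m" by (simp add: algebra_simps)
    moreover have "\<not> int p dvd 2"
    proof
      assume "int p dvd 2"
      then have "int p dvd int 2" by simp
      then have "p dvd 2" by (simp only: int_dvd_int_iff)
      then show False using p primes_dvd_imp_eq[of p 2] by auto
    qed
    ultimately have "int p dvd m"
      using pp prime_dvd_mult_iff by blast
    then have "int p dvd m\<^sup>2" by (simp add: power2_eq_square)
    with pm have "int p dvd 1" using dvd_add_right_iff by blast
    then show False using pp by auto
  qed
  then consider "coprime (int p ^ j) (n - m)" | "coprime (int p ^ j) (n + m)"
    using prime_imp_coprime[OF pp] by (auto simp: coprime_power_left_iff)
  then show ?thesis
    using d by cases (auto simp: coprime_dvd_mult_left_iff coprime_dvd_mult_right_iff)
qed auto

lemma card_roots_upto: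
  fixes p j X :: nat
  assumes p: "prime p" "odd p"
  shows "card {n\<in>{1..X}. p ^ j dvd n\<^sup>2 + 1} \<le> 2 * (X div p ^ j + 1)"
proof (cases "{n\<in>{1..X}. p ^ j dvd n\<^sup>2 + 1} = {}")
  case False
  then obtain m where m: "m \<in> {1..X}" "p ^ j dvd m\<^sup>2 + 1" by blast
  have q: "p ^ j > 0" using p by (simp add: prime_gt_0_nat)
  define b where "b = nat ((- int m) mod int (p ^ j))"
  have "{n\<in>{1..X}. p ^ j dvd n\<^sup>2 + 1}
      \<subseteq> {n\<in>{1..X}. n mod p ^ j = m mod p ^ j} \<union> {n\<in>{1..X}. n mod p ^ j = b}"
  proof
    fix n assume n: "n \<in> {n\<in>{1..X}. p ^ j dvd n\<^sup>2 + 1}"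
    have "int (p ^ j) dvd int (n\<^sup>2 + 1)" "int (p ^ j) dvd int (m\<^sup>2 + 1)"
      using n m by (simp_all only: int_dvd_int_iff mem_Collect_eq)
    then have "int p ^ j dvd (int n)\<^sup>2 + 1" "int p ^ j dvd (int m)\<^sup>2 + 1"
      by (simp_all add: add.commute)
    then have "int p ^ j dvd int n - int m \<or> int p ^ j dvd int n + int m"
      using sqrt_minus_one_unique_up_to_sign[OF p] by blast
    then show "n \<in> {n\<in>{1..X}. n mod p ^ j = m mod p ^ j} \<union> {n\<in>{1..X}. n mod p ^ j = b}"
    proof
      assume "int p ^ j dvd int n - int m"
      then have "int n mod int (p ^ j) = int m mod int (p ^ j)"
        by (simp add: mod_eq_dvd_iff)
      then have "n mod p ^ j = m mod p ^ j"
        by (metis of_nat_mod of_nat_eq_iff)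
      then show ?thesis using n by auto
    next
      assume "int p ^ j dvd int n + int m"
      then have "int n mod int (p ^ j) = (- int m) mod int (p ^ j)"
        by (simp add: mod_eq_dvd_iff)
      then have "n mod p ^ j = b"
        unfolding b_def by (metis of_nat_mod nat_int)
      then show ?thesis using n by auto
    qed
  qed
  then have "card {n\<in>{1..X}. p ^ j dvd n\<^sup>2 + 1}
      \<le> card ({n\<in>{1..X}. n mod p ^ j = m mod p ^ j} \<union> {n\<in>{1..X}. n mod p ^ j = b})"
    by (intro card_mono) auto
  also have "\<dots> \<le> card {n\<in>{1..X}. n mod p ^ j = m mod p ^ j} + card {n\<in>{1..X}. n mod p ^ j = b}"
    by (rule card_Un_le)
  also have "\<dots> \<le> (X div p ^ j + 1) + (X div p ^ j + 1)"
    by (intro add_mono card_residue_class_upto q)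
  finally show ?thesis by simp
next
  case True
  then show ?thesis by (simp only: card.empty)
qed

lemma geometric_tail_le:
  fixes x :: real
  assumes "x \<ge> 3"
  shows "(\<Sum>j\<in>{1..J::nat}. 1 / x ^ j) \<le> 3 / 2 / x"
proof -
  have "(\<Sum>j\<in>{1..J::nat}. 1 / x ^ j) = (1 - 1 / x ^ J) / (x - 1)"
  proof (induction J)
    case (Suc J)
    have "(\<Sum>j\<in>{1..Suc J}. 1 / x ^ j) = (1 - 1 / x ^ J) / (x - 1) + 1 / x ^ Suc J"
      using Suc by simp
    also have "\<dots> = (1 - 1 / x ^ Suc J) / (x - 1)"
      using assms by (simp add: divide_simps) (simp add: algebra_simps)
    finally show ?case .
  qed simp
  also have "\<dots> \<le> 1 / (x - 1)"
    using assms by (intro divide_right_mono) auto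
  also have "\<dots> \<le> 3 / 2 / x"
    using assms by (simp add: field_simps)
  finally show ?thesis .
qed

lemma odd_prime_ge_3: "prime (p::nat) \<Longrightarrow> odd p \<Longrightarrow> p \<ge> 3"
  using prime_ge_2_nat[of p] by (cases "p = 2") auto

text \<open>
  The left-hand side is the contribution of \<open>p\<close> to the logarithm of the product of all
  \<open>n\<^sup>2 + 1\<close> with \<open>n \<le> X\<close>. Each power \<open>p ^ j\<close> divides at most \<open>2 * (X / p ^ j + 1)\<close> of these numbers;
  the first summand adds up to a geometric series, and the second is met only for the
  exponents \<open>j\<close> with \<open>p ^ j \<le> X\<^sup>2 + 1\<close>.
\<close>
lemma sum_multiplicity_le:
  fixes p X :: nat
  assumes p: "prime p" "odd p" and X: "X \<ge> 1"
  shows "(\<Sum>n\<in>{1..X}. real (multiplicity p (n\<^sup>2 + 1)) * ln (real p))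
     \<le> 3 * real X * (ln (real p) / real p) + 2 * ln (real (X\<^sup>2 + 1))"
proof -
  \<comment> \<open>The largest exponent \<open>j\<close> for which \<open>p ^ j \<le> X\<^sup>2 + 1\<close>.\<close>
  define J where "J = nat \<lfloor>ln (real (X\<^sup>2 + 1)) / ln (real p)\<rfloor>"
  have lnp: "ln (real p) > 0" using prime_gt_1_real[OF p(1)] by simp
  have J: "j \<le> J" if j: "p ^ j dvd n\<^sup>2 + 1" and n: "n \<in> {1..X}" for j n
  proof -
    have "p ^ j \<le> n\<^sup>2 + 1" using j by (intro dvd_imp_le) auto
    also have "\<dots> \<le> X\<^sup>2 + 1" using n by (simp add: power_mono)
    finally have "real (p ^ j) \<le> real (X\<^sup>2 + 1)" by (simp only: of_nat_le_iff)
    then have "ln (real p ^ j) \<le> ln (real (X\<^sup>2 + 1))"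
      using prime_gt_1_real[OF p(1)] by (subst ln_le_cancel_iff) (auto simp: add_pos_nonneg)
    then have "real j * ln (real p) \<le> ln (real (X\<^sup>2 + 1))"
      using prime_gt_1_real[OF p(1)] by (simp add: ln_realpow)
    then have "real j \<le> ln (real (X\<^sup>2 + 1)) / ln (real p)"
      using lnp by (simp add: field_simps)
    then show ?thesis unfolding J_def by (simp add: le_nat_floor)
  qed
  have mult: "multiplicity p (n\<^sup>2 + 1) = card {j\<in>{1..J}. p ^ j dvd n\<^sup>2 + 1}" if n: "n \<in> {1..X}" for n
  proof -
    have "{j\<in>{1..J}. p ^ j dvd n\<^sup>2 + 1} = {1..multiplicity p (n\<^sup>2 + 1)}"
    proof (intro set_eqI iffI)
      fix j assume j: "j \<in> {1..multiplicity p (n\<^sup>2 + 1)}"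
      then have "p ^ j dvd n\<^sup>2 + 1" by (intro multiplicity_dvd') auto
      with J[OF this n] j show "j \<in> {j\<in>{1..J}. p ^ j dvd n\<^sup>2 + 1}" by auto
    next
      fix j assume j: "j \<in> {j\<in>{1..J}. p ^ j dvd n\<^sup>2 + 1}"
      then have "multiplicity p (n\<^sup>2 + 1) \<ge> j"
        using p by (intro multiplicity_geI) (auto simp: prime_gt_1_nat)
      with j show "j \<in> {1..multiplicity p (n\<^sup>2 + 1)}" by auto
    qed
    then show ?thesis by simp
  qed
  have "(\<Sum>n\<in>{1..X}. multiplicity p (n\<^sup>2 + 1))
      = (\<Sum>n\<in>{1..X}. \<Sum>j\<in>{j\<in>{1..J}. p ^ j dvd n\<^sup>2 + 1}. 1)"
    by (intro sum.cong refl) (simp only: mult card_eq_sum)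
  also have "\<dots> = (\<Sum>j\<in>{1..J}. \<Sum>n\<in>{n\<in>{1..X}. p ^ j dvd n\<^sup>2 + 1}. 1)"
    by (rule sum.swap_restrict) auto
  also have "\<dots> \<le> (\<Sum>j\<in>{1..J}. 2 * (X div p ^ j + 1))"
    unfolding card_eq_sum[symmetric] by (intro sum_mono card_roots_upto p)
  finally have "real (\<Sum>n\<in>{1..X}. multiplicity p (n\<^sup>2 + 1)) \<le> real (\<Sum>j\<in>{1..J}. 2 * (X div p ^ j + 1))"
    by (simp only: of_nat_le_iff)
  also have "\<dots> \<le> (\<Sum>j\<in>{1..J}. 2 * real X * (1 / real p ^ j) + 2)"
    unfolding of_nat_sum
  proof (intro sum_mono)
    fix j
    show "real (2 * (X div p ^ j + 1)) \<le> 2 * real X * (1 / real p ^ j) + 2"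
      using of_nat_div_le_of_nat[where 'a = real, of X "p ^ j"] by simp
  qed
  also have "\<dots> = 2 * real X * (\<Sum>j\<in>{1..J}. 1 / real p ^ j) + 2 * real J"
    by (simp add: sum.distrib sum_distrib_left)
  also have "\<dots> \<le> 2 * real X * (3 / 2 / real p) + 2 * real J"
    using odd_prime_ge_3[OF p] by (intro add_mono mult_left_mono geometric_tail_le) auto
  finally have "real (\<Sum>n\<in>{1..X}. multiplicity p (n\<^sup>2 + 1)) * ln (real p)
      \<le> (3 * real X / real p + 2 * real J) * ln (real p)"
    using lnp by (intro mult_right_mono) auto
  also have "real J * ln (real p) \<le> ln (real (X\<^sup>2 + 1))"
  proof -
    have "real J \<le> ln (real (X\<^sup>2 + 1)) / ln (real p)"
      unfolding J_def using lnp by (intro of_nat_floor) (auto intro!: divide_nonneg_nonneg ln_ge_zero)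
    then show ?thesis using lnp by (simp add: field_simps)
  qed
  then have "(3 * real X / real p + 2 * real J) * ln (real p)
     \<le> 3 * real X * (ln (real p) / real p) + 2 * ln (real (X\<^sup>2 + 1))"
    by (simp add: algebra_simps)
  finally show ?thesis by (simp add: sum_distrib_right)
qed

lemma multiplicity_2_square_plus_1: "multiplicity 2 (n\<^sup>2 + 1 :: nat) \<le> 1"
proof (rule ccontr)
  assume "\<not> ?thesis"
  then have "2 ^ 2 dvd n\<^sup>2 + 1" by (intro multiplicity_dvd') auto
  then have d: "4 dvd n\<^sup>2 + 1" by simp
  have no: "\<not> 4 dvd 4 * m + 1" "\<not> 4 dvd 4 * m + 2" for m :: nat
    by (simp_all add: dvd_eq_mod_eq_0 mod_Suc)
  show False
  proof (cases "even n")
    case True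
    then obtain k where "n = 2 * k" by (elim evenE)
    then have eq: "n\<^sup>2 + 1 = 4 * k\<^sup>2 + 1" by (simp add: power2_eq_square)
    show False using d no unfolding eq by blast
  next
    case False
    then obtain k where "n = 2 * k + 1" by (elim oddE)
    then have eq: "n\<^sup>2 + 1 = 4 * (k\<^sup>2 + k) + 2" by (simp add: power2_eq_square algebra_simps)
    show False using d no unfolding eq by blast
  qed
qed

definition primes_dividing_squares_plus_one :: "nat \<Rightarrow> nat set" where
  "primes_dividing_squares_plus_one X =
     {p. prime p \<and> odd p \<and> (\<exists>n\<in>{1..X}. p dvd n\<^sup>2 + 1)}"

lemma primes_dividing_squares_plus_one_le:
  assumes "p \<in> primes_dividing_squares_plus_one X"
  shows "p \<le> X\<^sup>2 + 1"
proof -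
  obtain n where n: "n \<le> X" "p dvd n\<^sup>2 + 1"
    using assms by (auto simp: primes_dividing_squares_plus_one_def)
  then have "p \<le> n\<^sup>2 + 1" by (intro dvd_imp_le) auto
  also have "\<dots> \<le> X\<^sup>2 + 1" using n by (simp add: power_mono)
  finally show ?thesis .
qed

lemma finite_primes_dividing_squares_plus_one:
  "finite (primes_dividing_squares_plus_one X)"
  by (rule finite_subset[of _ "{..X\<^sup>2 + 1}"]) (auto dest: primes_dividing_squares_plus_one_le)

text \<open>The lower bound of Stirling's formula for \<open>ln (X!)\<close>, without lower-order terms.\<close>

lemma sum_ln_upto_ge: "X \<ge> 1 \<Longrightarrow> (\<Sum>n\<in>{1..X::nat}. ln (real n)) \<ge> real X * ln (real X) - real X"
proof (induction X rule: dec_induct)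
  case (step X)
  have X: "real X > 0" using step by simp
  have "ln (real (Suc X)) - ln (real X) = ln (real (Suc X) / real X)"
    using X by (simp add: ln_div)
  also have "real (Suc X) / real X = 1 + 1 / real X"
    using X by (simp add: field_simps)
  also have "ln (1 + 1 / real X) \<le> 1 / real X" using X by (intro ln_add_one_self_le_self) auto
  finally have "real X * ln (real (Suc X)) \<le> real X * ln (real X) + 1"
    using X by (simp add: field_simps)
  with step.IH show ?case by (simp add: algebra_simps)
qed simp

text \<open>
  With \<open>X = Y ^ 12\<close> and \<open>L = ln X\<close>, the product of all \<open>n\<^sup>2 + 1\<close> with \<open>n \<le> X\<close> has logarithm
  about \<open>2 * X * L\<close>. The odd primes up to \<open>Y\<close> account for at most \<open>6 * X * ln Y = X * L / 2\<close> of this,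
  the choice of the exponent 12 being made to leave room. If there were at most
  \<open>Y / 24\<close> odd prime divisors altogether, those above \<open>Y\<close> would contribute at most another
  \<open>3 * X * L / 8\<close>, the error terms at most \<open>X * L / 4\<close>, and the prime 2 at most \<open>X\<close>. The
  total falls short of \<open>2 * X * L\<close>.
\<close>
theorem many_primes_dividing_squares_plus_one:
  assumes Y: "Y \<ge> (2::nat)"
  shows "real Y < 24 * real (card (primes_dividing_squares_plus_one (Y ^ 12)))"
proof (rule ccontr)
  define X where "X = Y ^ 12"
  define P where "P = primes_dividing_squares_plus_one X"
  define L where "L = ln (real X)"
  assume "\<not> ?thesis"
  then have K: "24 * real (card P) \<le> real Y" by (simp add: P_def X_def)
  have finP: "finite P" by (simp add: P_def finite_primes_dividing_squares_plus_one)
  have P: "prime p" "odd p" "p \<le> X\<^sup>2 + 1" if "p \<in> P" for p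
    using that primes_dividing_squares_plus_one_le[of p X]
    by (auto simp: P_def primes_dividing_squares_plus_one_def)
  have two: "2 \<notin> P" using P(2)[of 2] by auto
  have "(2::nat) ^ 12 \<le> X" unfolding X_def using Y by (rule power_mono) simp
  then have X: "X \<ge> 4096" by simp
  have "ln (exp 4) \<le> ln (real X)"
  proof (subst ln_le_cancel_iff)
    have "exp (4::real) = exp 1 ^ 4" by (simp flip: exp_of_nat_mult)
    also have "\<dots> \<le> 3 ^ 4" by (intro power_mono exp_le) auto
    finally show "exp 4 \<le> real X" using X by simp
  qed (use X in auto)
  then have L3: "L \<ge> 4" by (simp add: L_def)
  have LY: "ln (real Y) = L / 12" using Y by (simp add: L_def X_def ln_realpow)
  have YX: "real Y \<le> real X" unfolding X_def using Y self_le_power[of Y 12] by simp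
  have lnX: "ln (real (X\<^sup>2 + 1)) \<le> 3 * L"
  proof -
    have "X\<^sup>2 + 1 \<le> X\<^sup>2 + X\<^sup>2" using X by (simp add: Suc_leI)
    also have "\<dots> = 2 * X\<^sup>2" by simp
    also have "\<dots> \<le> X * X\<^sup>2" using X by (intro mult_right_mono) auto
    also have "\<dots> = X ^ 3" by (simp add: power3_eq_cube power2_eq_square)
    finally have "X\<^sup>2 + 1 \<le> X ^ 3" .
    then have "real (X\<^sup>2 + 1) \<le> real (X ^ 3)" by (simp only: of_nat_le_iff)
    then have "real (X\<^sup>2 + 1) \<le> real X ^ 3" by simp
    then have "ln (real (X\<^sup>2 + 1)) \<le> ln (real X ^ 3)" using X by (subst ln_le_cancel_iff) (auto simp: add_pos_nonneg)
    then show ?thesis using X by (simp add: ln_realpow L_def)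
  qed

  have expand: "ln (real (n\<^sup>2 + 1)) \<le>
      (\<Sum>p\<in>P. real (multiplicity p (n\<^sup>2 + 1)) * ln (real p)) + ln 2" if n: "n \<in> {1..X}" for n
  proof -
    have "ln (real (n\<^sup>2 + 1)) = (\<Sum>p\<in>prime_factors (n\<^sup>2 + 1). real (multiplicity p (n\<^sup>2 + 1)) * ln (real p))"
      by (rule ln_eq_sum_multiplicity) simp
    also have "\<dots> \<le> (\<Sum>p\<in>insert 2 P. real (multiplicity p (n\<^sup>2 + 1)) * ln (real p))"
    proof (rule sum_mono2)
      show "prime_factors (n\<^sup>2 + 1) \<subseteq> insert 2 P"
      proof
        fix p assume "p \<in> prime_factors (n\<^sup>2 + 1)"
        then have p: "prime p" "p dvd n\<^sup>2 + 1" by (auto simp: in_prime_factors_iff)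
        show "p \<in> insert 2 P"
        proof (cases "p = 2")
          case False
          then have "odd p" using p(1) prime_odd_nat[of p] prime_ge_2_nat[of p] by simp
          with p n show ?thesis
            by (auto simp: P_def primes_dividing_squares_plus_one_def)
        qed simp
      qed
    next
      fix p assume "p \<in> insert 2 P - prime_factors (n\<^sup>2 + 1)"
      then have "prime p" using P(1) by auto
      then show "0 \<le> real (multiplicity p (n\<^sup>2 + 1)) * ln (real p)"
        by (intro mult_nonneg_nonneg ln_prime_ge_0 of_nat_0_le_iff)
    qed (use finP in simp)
    also have "\<dots> = real (multiplicity 2 (n\<^sup>2 + 1)) * ln 2 + (\<Sum>p\<in>P. real (multiplicity p (n\<^sup>2 + 1)) * ln (real p))"
      using two finP by simp
    also have "real (multiplicity 2 (n\<^sup>2 + 1)) * ln 2 \<le> 1 * ln 2"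
      using multiplicity_2_square_plus_1[of n] by (intro mult_right_mono) auto
    finally show ?thesis by simp
  qed

  \<comment> \<open>Primes above \<open>Y\<close> are few by assumption, and each adds at most \<open>3 * L / Y\<close>.\<close>
  have mertens: "(\<Sum>p\<in>P. ln (real p) / real p) \<le> 2 * ln (real Y) + 3 * L * real (card P) / real Y"
  proof -
    have "(\<Sum>p\<in>P. ln (real p) / real p)
        = (\<Sum>p\<in>{p\<in>P. p \<le> Y}. ln (real p) / real p) + (\<Sum>p\<in>{p\<in>P. \<not> p \<le> Y}. ln (real p) / real p)"
      using finP by (subst sum.union_disjoint[symmetric]) (auto intro!: sum.cong)
    also have "(\<Sum>p\<in>{p\<in>P. p \<le> Y}. ln (real p) / real p) \<le> (\<Sum>p | prime p \<and> p \<le> Y. ln (real p) / real p)"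
    proof (rule sum_mono2)
      show "finite {p. prime p \<and> p \<le> Y}" by (rule finite_subset[of _ "{..Y}"]) auto
      show "{p\<in>P. p \<le> Y} \<subseteq> {p. prime p \<and> p \<le> Y}" using P(1) by blast
    qed (use ln_prime_ge_0 in auto)
    also have "\<dots> \<le> 2 * ln (real Y)" using Y by (intro sum_ln_over_primes_le) auto
    also have "(\<Sum>p\<in>{p\<in>P. \<not> p \<le> Y}. ln (real p) / real p) \<le> real (card {p\<in>P. \<not> p \<le> Y}) * (3 * L / real Y)"
    proof (rule sum_bounded_above)
      fix p assume p: "p \<in> {p\<in>P. \<not> p \<le> Y}"
      then have "real p \<le> real (X\<^sup>2 + 1)" using P(3)[of p] by (simp only: of_nat_le_iff) auto
      then have "ln (real p) \<le> ln (real (X\<^sup>2 + 1))"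
        using p Y by (subst ln_le_cancel_iff) auto
      also note lnX
      finally show "ln (real p) / real p \<le> 3 * L / real Y"
        using p Y L3 by (intro frac_le) auto
    qed
    also have "\<dots> \<le> real (card P) * (3 * L / real Y)"
      using finP L3 by (intro mult_right_mono) (auto intro: card_mono)
    finally show ?thesis by (simp add: mult_ac)
  qed

  have "2 * (real X * L - real X) \<le> 2 * (\<Sum>n\<in>{1..X}. ln (real n))"
    using sum_ln_upto_ge[of X] X by (simp add: L_def)
  also have "\<dots> = (\<Sum>n\<in>{1..X}. ln (real n ^ 2))"
    unfolding sum_distrib_left by (intro sum.cong refl) (auto simp: ln_realpow)
  also have "\<dots> \<le> (\<Sum>n\<in>{1..X}. ln (real (n\<^sup>2 + 1)))"
    by (intro sum_mono) (auto simp: add_pos_pos)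
  also have "\<dots> \<le> (\<Sum>n\<in>{1..X}. (\<Sum>p\<in>P. real (multiplicity p (n\<^sup>2 + 1)) * ln (real p)) + ln 2)"
    by (intro sum_mono expand)
  also have "\<dots> = (\<Sum>p\<in>P. \<Sum>n\<in>{1..X}. real (multiplicity p (n\<^sup>2 + 1)) * ln (real p)) + real X * ln 2"
    by (simp add: sum.distrib sum.swap[of _ P])
  also have "\<dots> \<le> (\<Sum>p\<in>P. 3 * real X * (ln (real p) / real p) + 2 * ln (real (X\<^sup>2 + 1))) + real X * ln 2"
    using X by (intro add_mono sum_mono sum_multiplicity_le P order.refl) auto
  also have "\<dots> = 3 * real X * (\<Sum>p\<in>P. ln (real p) / real p) + 2 * ln (real (X\<^sup>2 + 1)) * real (card P) + real X * ln 2"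
    by (simp add: sum.distrib sum_distrib_left)
  also have "\<dots> \<le> 3 * real X * (2 * ln (real Y) + 3 * L * real (card P) / real Y) + 2 * (3 * L) * real (card P) + real X * 1"
    using ln2_le_25_over_36 by (intro add_mono mult_left_mono mult_right_mono mertens lnX) auto
  finally have main: "2 * (real X * L - real X) \<le>
      3 * real X * (2 * ln (real Y) + 3 * L * real (card P) / real Y) + 6 * L * real (card P) + real X"
    by simp
  have "3 * L * real (card P) / real Y \<le> L / 8"
    using mult_left_mono[OF K, of L] Y L3 by (simp add: field_simps)
  then have "3 * real X * (2 * ln (real Y) + 3 * L * real (card P) / real Y) \<le> 3 * real X * (2 * (L / 12) + L / 8)"
    unfolding LY by (intro mult_left_mono) auto
  moreover have "6 * L * real (card P) \<le> real X * L / 4"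
    using mult_left_mono[OF order.trans[OF K YX], of L] L3 by (simp add: field_simps)
  ultimately have "2 * (real X * L - real X) \<le> 3 * real X * (2 * (L / 12) + L / 8) + real X * L / 4 + real X"
    using main by linarith
  then have "real X * (7 / 8 * L) \<le> real X * 3" by (simp add: algebra_simps)
  then have "7 / 8 * L \<le> 3" using X by (simp only: mult_le_cancel_left_pos of_nat_0_less_iff)
  with L3 show False by simp
qed

section \<open>Counting pairs in lattices\<close>

lemma sum_card_swap:
  assumes "finite A" "finite B"
  shows "(\<Sum>x\<in>A. card {y\<in>B. R x y}) = (\<Sum>y\<in>B. card {x\<in>A. R x y})"
  unfolding card_eq_sum by (rule sum.swap_restrict[OF assms])

text \<open>The Cauchy-Schwarz inequality for the sizes of the fibres of \<open>f\<close>.\<close>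

lemma card_squared_le_collisions:
  assumes "finite A" "finite V" "f ` A \<subseteq> V"
  shows "(card A)\<^sup>2 \<le> card V * card {z\<in>A \<times> A. f (fst z) = f (snd z)}"
proof -
  define c where "c v = card {x\<in>A. f x = v}" for v
  have A: "card A = (\<Sum>v\<in>V. c v)"
  proof -
    have "(\<Sum>v\<in>V. c v) = (\<Sum>x\<in>A. card {v\<in>V. f x = v})"
      unfolding c_def by (rule sum_card_swap) (use assms in auto)
    also have "\<dots> = (\<Sum>x\<in>A. 1)"
    proof (intro sum.cong refl)
      fix x assume "x \<in> A"
      then have "{v\<in>V. f x = v} = {f x}" using assms by auto
      then show "card {v\<in>V. f x = v} = 1" by simp
    qed
    finally show ?thesis by simp
  qed
  have col: "card {z\<in>A \<times> A. f (fst z) = f (snd z)} = (\<Sum>v\<in>V. (c v)\<^sup>2)"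
  proof -
    have "{z\<in>A \<times> A. f (fst z) = f (snd z)} = (\<Union>v\<in>V. {x\<in>A. f x = v} \<times> {x\<in>A. f x = v})"
      using assms by auto
    also have "card \<dots> = (\<Sum>v\<in>V. card ({x\<in>A. f x = v} \<times> {x\<in>A. f x = v}))"
      using assms by (intro card_UN_disjoint) auto
    finally show ?thesis by (simp add: c_def power2_eq_square card_cartesian_product)
  qed
  have "(\<Sum>v\<in>V. real (c v))\<^sup>2 \<le> (\<Sum>v\<in>V. (real (c v))\<^sup>2) * real (card V)"
    by (rule sum_squared_le_sum_of_squares)
  then have "real ((card A)\<^sup>2) \<le> real (card V * card {z\<in>A \<times> A. f (fst z) = f (snd z)})"
    by (simp add: A col mult.commute)
  then show ?thesis by (simp only: of_nat_le_iff)
qed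

definition norm_sq :: "int \<times> int \<Rightarrow> int" where
  "norm_sq d = (fst d)\<^sup>2 + (snd d)\<^sup>2"

text \<open>
  The set \<open>S\<close> encodes a choice of sign for each prime, which corresponds to the choice of one
  of the two conjugate Gaussian primes above it.
\<close>
definition signed_root :: "(nat \<Rightarrow> int) \<Rightarrow> nat set \<Rightarrow> nat \<Rightarrow> int" where
  "signed_root r S p = (if p \<in> S then r p else - r p)"

text \<open>
  Identifying \<open>(a, b)\<close> with \<open>a + b * \<i>\<close>, this is the ideal generated by the
  product of the chosen Gaussian primes.
\<close>
definition root_lattice :: "(nat \<Rightarrow> int) \<Rightarrow> nat set \<Rightarrow> nat set \<Rightarrow> (int \<times> int) set" where
  "root_lattice r P S = {d. \<forall>p\<in>P. int p dvd fst d - signed_root r S p * snd d}"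

definition minus_one_roots :: "(nat \<Rightarrow> int) \<Rightarrow> nat set \<Rightarrow> bool" where
  "minus_one_roots r P \<longleftrightarrow>
     finite P \<and> (\<forall>p\<in>P. prime p \<and> odd p \<and> int p dvd (r p)\<^sup>2 + 1)"

text \<open>
  The lattice has at most \<open>\<Prod>P\<close> cosets, a coset being determined by one residue modulo each
  \<open>p\<close>. The collisions counted by Cauchy-Schwarz are the pairs in a common coset.
\<close>
lemma card_squared_le_lattice_pairs:
  assumes "finite A" "finite P" "0 \<notin> P"
  shows "(card A)\<^sup>2 \<le> \<Prod>P * card {z\<in>A \<times> A. fst z - snd z \<in> root_lattice r P S}"
proof -
  define f where "f x = (\<lambda>p\<in>P. (fst x - signed_root r S p * snd x) mod int p)" for x :: "int \<times> int"
  define V where "V = (\<Pi>\<^sub>E p\<in>P. {0..<int p})"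
  have V: "finite V" "card V = \<Prod>P"
    using assms by (auto simp: V_def card_PiE finite_PiE)
  have pos: "int p > 0" if "p \<in> P" for p using that assms by (cases p) auto
  have "f ` A \<subseteq> V"
    using pos by (auto simp: f_def V_def)
  moreover have "f x = f y \<longleftrightarrow> x - y \<in> root_lattice r P S" for x y
  proof -
    have "f x = f y \<longleftrightarrow> (\<forall>p\<in>P. (fst x - signed_root r S p * snd x) mod int p = (fst y - signed_root r S p * snd y) mod int p)"
      unfolding f_def by (metis (no_types, lifting) restrict_apply' restrict_ext)
    also have "\<dots> \<longleftrightarrow> x - y \<in> root_lattice r P S"
      unfolding root_lattice_def mod_eq_dvd_iff by (simp add: algebra_simps)
    finally show ?thesis .
  qed
  ultimately show ?thesis
    using card_squared_le_collisions[of A V f] V assms by simp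
qed

lemma prod_prime_powers_dvd:
  fixes n :: int and e :: "nat \<Rightarrow> nat"
  assumes "finite P" "\<And>p. p \<in> P \<Longrightarrow> prime p" "\<And>p. p \<in> P \<Longrightarrow> int p ^ e p dvd n"
  shows "(\<Prod>p\<in>P. int p ^ e p) dvd n"
  using assms
proof (induction P)
  case (insert p P)
  have "coprime (int p ^ e p) (\<Prod>q\<in>P. int q ^ e q)"
    using insert by (intro prod_coprime_right coprime_power_left_iff[THEN iffD2]
      coprime_power_right_iff[THEN iffD2] disjI1) (auto intro!: primes_coprime)
  with insert show ?case by (simp add: divides_mult)
qed auto

text \<open>
  Compare the sign choices \<open>S\<close> whose lattice contains \<open>d = (a, b)\<close> with a fixed one \<open>S0\<close>. Membership in
  one lattice makes \<open>a\<^sup>2 + b\<^sup>2\<close> divisible by every \<open>p\<close>. At a prime where \<open>S\<close> and \<open>S0\<close> differ,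
  both signs are admissible, which forces \<open>p\<close> to divide \<open>a\<close> and \<open>b\<close> and so \<open>p\<^sup>2\<close> to
  divide \<open>a\<^sup>2 + b\<^sup>2\<close>. Hence the symmetric difference of \<open>S\<close> and \<open>S0\<close>, which determines \<open>S\<close>, is a set \<open>T\<close> of the
  required kind. The right-hand side depends on \<open>d\<close> through its norm only; this makes the
  count usable for a set in which each norm occurs at most once.
\<close>
lemma card_lattices_containing_le:
  assumes "minus_one_roots r P"
  shows "card {S\<in>Pow P. d \<in> root_lattice r P S}
       \<le> card {T\<in>Pow P. int (\<Prod>P * \<Prod>T) dvd norm_sq d}"
proof (cases "{S\<in>Pow P. d \<in> root_lattice r P S} = {}")
  case False
  then obtain S0 where S0: "S0 \<subseteq> P" "d \<in> root_lattice r P S0" by blast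
  obtain a b where d: "d = (a, b)" by (cases d)
  have P: "prime p" "odd p" "int p dvd (r p)\<^sup>2 + 1" if "p \<in> P" for p
    using assms that by (auto simp: minus_one_roots_def)
  have finP: "finite P" using assms by (simp add: minus_one_roots_def)
  have once: "int p dvd a\<^sup>2 + b\<^sup>2" if p: "p \<in> P" for p
  proof -
    define s where "s = signed_root r S0 p"
    have "int p dvd a - s * b" using S0(2) p by (auto simp: root_lattice_def d s_def)
    then have "int p dvd (a - s * b) * (a + s * b)" by (rule dvd_mult2)
    moreover have "s\<^sup>2 = (r p)\<^sup>2" by (simp add: s_def signed_root_def)
    then have "int p dvd b\<^sup>2 * (s\<^sup>2 + 1)" using P(3)[OF p] by simp
    ultimately have "int p dvd (a - s * b) * (a + s * b) + b\<^sup>2 * (s\<^sup>2 + 1)" by (rule dvd_add)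
    also have "(a - s * b) * (a + s * b) + b\<^sup>2 * (s\<^sup>2 + 1) = a\<^sup>2 + b\<^sup>2"
      by (simp add: algebra_simps power2_eq_square)
    finally show ?thesis .
  qed
  have twice: "int p ^ 2 dvd a\<^sup>2 + b\<^sup>2"
    if p: "p \<in> P" and S: "d \<in> root_lattice r P S" "p \<in> S \<longleftrightarrow> p \<notin> S0" for p S
  proof -
    have pp: "prime (int p)" using P[OF p] by simp
    have 1: "int p dvd a - r p * b" and 2: "int p dvd a + r p * b"
      using S S0(2) p by (auto simp: root_lattice_def d signed_root_def split: if_splits)
    have n2: "\<not> int p dvd 2"
    proof
      assume "int p dvd 2"
      then have "int p dvd int 2" by simp
      then have "p dvd 2" by (simp only: int_dvd_int_iff)
      then show False using P[OF p] primes_dvd_imp_eq[of p 2] by auto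
    qed
    have "int p dvd 2 * a" using dvd_add[OF 1 2] by simp
    then have a: "int p dvd a" using pp n2 prime_dvd_mult_iff by blast
    then have "int p dvd r p * b" using 2 by (simp add: dvd_add_right_iff)
    moreover have "\<not> int p dvd r p"
    proof
      assume "int p dvd r p"
      then have "int p dvd (r p)\<^sup>2" by (simp add: power2_eq_square)
      with P(3)[OF p] have "int p dvd 1" using dvd_add_right_iff by blast
      then show False using pp by auto
    qed
    ultimately have b: "int p dvd b" using pp prime_dvd_mult_iff by blast
    show ?thesis using a b by (intro dvd_add dvd_power_same)
  qed
  have "card {S\<in>Pow P. d \<in> root_lattice r P S} \<le> card {T\<in>Pow P. int (\<Prod>P * \<Prod>T) dvd norm_sq d}"
  proof (rule card_inj_on_le)
    show "inj_on (\<lambda>S. sym_diff S S0) {S\<in>Pow P. d \<in> root_lattice r P S}"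
      by (rule inj_onI) blast
    show "finite {T\<in>Pow P. int (\<Prod>P * \<Prod>T) dvd norm_sq d}" using finP by simp
    show "(\<lambda>S. sym_diff S S0) ` {S\<in>Pow P. d \<in> root_lattice r P S} \<subseteq> {T\<in>Pow P. int (\<Prod>P * \<Prod>T) dvd norm_sq d}"
    proof (rule image_subsetI)
      fix S assume "S \<in> {S\<in>Pow P. d \<in> root_lattice r P S}"
      then have S: "S \<subseteq> P" "d \<in> root_lattice r P S" by auto
      define T where "T = sym_diff S S0"
      have T: "T \<subseteq> P" using S S0 by (auto simp: T_def)
      have "int (\<Prod>P * \<Prod>T) = (\<Prod>p\<in>P. int p) * (\<Prod>p\<in>P. if p \<in> T then int p else 1)"
        using T finP by (simp add: prod.If_cases Int_absorb1)
      also have "\<dots> = (\<Prod>p\<in>P. int p ^ (if p \<in> T then 2 else 1))"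
        unfolding prod.distrib[symmetric] by (intro prod.cong refl) (simp add: power2_eq_square)
      also have "\<dots> dvd a\<^sup>2 + b\<^sup>2"
        using finP P once twice S by (intro prod_prime_powers_dvd) (auto simp: T_def)
      finally show "sym_diff S S0 \<in> {T\<in>Pow P. int (\<Prod>P * \<Prod>T) dvd norm_sq d}"
        using T by (simp add: T_def norm_sq_def d)
    qed
  qed
  then show ?thesis .
next
  case True
  then show ?thesis by (simp only: card.empty)
qed

text \<open>The integer form of the absence of repeated distances.\<close>

definition norm_determines_pair :: "(int \<times> int) set \<Rightarrow> bool" where
  "norm_determines_pair B \<longleftrightarrow>
     (\<forall>p\<in>B. \<forall>q\<in>B. \<forall>u\<in>B. \<forall>v\<in>B.
        p \<noteq> q \<longrightarrow> u \<noteq> v \<longrightarrow> norm_sq (p - q) = norm_sq (u - v) \<longrightarrow> {p, q} = {u, v})"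

text \<open>
  The norms of the differences in question are multiples of \<open>q\<close> between 1 and \<open>2 * N\<^sup>2\<close>, and each
  multiple belongs to at most two ordered pairs, which are swapped versions of each other.
\<close>
lemma card_pairs_norm_dvd_le:
  assumes B: "B \<subseteq> {1..int N} \<times> {1..int N}" and nd: "norm_determines_pair B" and q: "q > 0"
  shows "card {z\<in>B \<times> B. fst z \<noteq> snd z \<and> int q dvd norm_sq (fst z - snd z)} \<le> 2 * (2 * N\<^sup>2 div q)"
proof -
  define Z where "Z = {z\<in>B \<times> B. fst z \<noteq> snd z \<and> int q dvd norm_sq (fst z - snd z)}"
  define M where "M = {m\<in>{1..2 * N\<^sup>2}. q dvd m}"
  define F where "F m = {z\<in>Z. norm_sq (fst z - snd z) = int m}" for m
  have "finite B" using B by (rule finite_subset) auto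
  then have finZ: "finite Z" by (simp add: Z_def)
  have "Z \<subseteq> (\<Union>m\<in>M. F m)"
  proof
    fix z assume z: "z \<in> Z"
    obtain x y where xy: "z = (x, y)" by (cases z)
    obtain a b where ab: "x = (a, b)" by (cases x)
    obtain c d where cd: "y = (c, d)" by (cases y)
    have z_eq: "z = ((a, b), (c, d))" by (simp only: xy ab cd)
    have "(a, b) \<in> B" "(c, d) \<in> B" using z by (simp_all add: Z_def z_eq)
    then have "(a, b) \<in> {1..int N} \<times> {1..int N}" "(c, d) \<in> {1..int N} \<times> {1..int N}"
      using subsetD[OF B] by blast+
    then have bounds: "\<bar>a - c\<bar> \<le> int N" "\<bar>b - d\<bar> \<le> int N"
      by (simp_all add: abs_le_iff)
    have "(a - c)\<^sup>2 \<le> (int N)\<^sup>2" "(b - d)\<^sup>2 \<le> (int N)\<^sup>2"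
      using bounds abs_le_square_iff[of "a - c" "int N"] abs_le_square_iff[of "b - d" "int N"]
      by simp_all
    then have le: "norm_sq (fst z - snd z) \<le> int (2 * N\<^sup>2)"
      by (simp add: norm_sq_def z_eq)
    have "a \<noteq> c \<or> b \<noteq> d" using z by (auto simp: Z_def z_eq)
    then have pos: "norm_sq (fst z - snd z) > 0"
      by (auto simp: norm_sq_def z_eq sum_power2_gt_zero_iff)
    define m where "m = nat (norm_sq (fst z - snd z))"
    have m: "norm_sq (fst z - snd z) = int m" using pos by (simp add: m_def)
    have "int q dvd int m" using z m by (simp add: Z_def)
    then have "q dvd m" by (simp only: int_dvd_int_iff)
    moreover have "m \<in> {1..2 * N\<^sup>2}" using le pos unfolding m by (simp only: of_nat_le_iff of_nat_0_less_iff) simp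
    ultimately have "m \<in> M" by (simp add: M_def)
    moreover have "z \<in> F m" using z m by (simp add: F_def)
    ultimately show "z \<in> (\<Union>m\<in>M. F m)" by (rule UN_I)
  qed
  then have "card Z \<le> card (\<Union>m\<in>M. F m)"
    using finZ by (intro card_mono) (auto simp: M_def F_def)
  also have "\<dots> \<le> (\<Sum>m\<in>M. card (F m))"
    by (rule card_UN_le) (simp add: M_def)
  also have "\<dots> \<le> (\<Sum>m\<in>M. 2)"
  proof (rule sum_mono)
    fix m
    show "card (F m) \<le> 2"
    proof (cases "F m = {}")
      case False
      then obtain x y where xy: "(x, y) \<in> F m" by auto
      have "F m \<subseteq> {(x, y), (y, x)}"
      proof
        fix z assume z: "z \<in> F m"
        obtain u v where z_eq: "z = (u, v)" by (cases z)
        have "{x, y} = {u, v}"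
        proof (rule nd[unfolded norm_determines_pair_def, rule_format])
          show "norm_sq (x - y) = norm_sq (u - v)" using z xy by (simp add: F_def z_eq)
        qed (use z xy in \<open>simp_all add: F_def Z_def z_eq\<close>)
        then show "z \<in> {(x, y), (y, x)}"
          by (auto simp: z_eq doubleton_eq_iff)
      qed
      then have "card (F m) \<le> card {(x, y), (y, x)}" by (rule card_mono[rotated]) simp
      also have "card {(x, y), (y, x)} \<le> 2" by (cases "x = y") simp_all
      finally show ?thesis .
    qed simp
  qed
  also have "\<dots> = 2 * (2 * N\<^sup>2 div q)"
    unfolding M_def using q by (simp only: sum_constant card_multiples_upto) simp
  finally show ?thesis by (simp only: Z_def)
qed

text \<open>The sum expands the product of the factors \<open>1 + 1 / p\<close>, each of which is at most \<open>4 / 3\<close>.\<close>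

lemma sum_inverse_subset_prods_le:
  fixes P :: "nat set"
  assumes "finite P" "\<And>p. p \<in> P \<Longrightarrow> p \<ge> 3"
  shows "(\<Sum>T\<in>Pow P. 1 / real (\<Prod>T)) \<le> (4 / 3) ^ card P"
proof -
  have "(\<Sum>T\<in>Pow P. 1 / real (\<Prod>T)) = (\<Prod>p\<in>P. 1 / real p + 1)"
    by (simp add: prod_add[OF assms(1)] prod_dividef)
  also have "\<dots> \<le> (\<Prod>p\<in>P. 4 / 3)"
    using assms(2) by (intro prod_mono) (fastforce simp: field_simps)
  finally show ?thesis by simp
qed

lemma le_sum_of_quadratic_le:
  fixes x m s :: real
  assumes "x\<^sup>2 \<le> m * x + s\<^sup>2" "m \<ge> 0" "s \<ge> 0"
  shows "x \<le> m + s"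
proof (rule ccontr)
  assume "\<not> ?thesis"
  then have x: "x > m + s" by simp
  then have "x * (m + s) < x * x" using assms by (intro mult_strict_left_mono) auto
  moreover have "s * s \<le> s * x" using x assms by (intro mult_left_mono) auto
  ultimately show False using assms(1) by (simp add: power2_eq_square algebra_simps)
qed

text \<open>
  Double counting of the pairs consisting of a sign choice and an ordered pair of points of \<open>B\<close> whose
  difference lies in the corresponding lattice. With \<open>m = \<Prod>P\<close> and \<open>k = card P\<close>, the lower bound
  \<open>2 ^ k * (card B)\<^sup>2 / m\<close> comes from Cauchy-Schwarz. In the upper bound, the diagonal gives
  \<open>2 ^ k * card B\<close>, and the other pairs give at most \<open>4 * N\<^sup>2 / (m * \<Prod>T)\<close> for each subset \<open>T\<close> of \<open>P\<close>,
  which amounts to \<open>(4 / 3) ^ k * 4 * N\<^sup>2 / m\<close>. It remains to solve the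
  resulting quadratic inequality for \<open>card B\<close>.
\<close>
theorem card_le_of_norm_determines_pair:
  assumes B: "B \<subseteq> {1..int N} \<times> {1..int N}" and nd: "norm_determines_pair B"
    and P: "minus_one_roots r P"
  shows "real (card B) \<le> real (\<Prod>P) + 2 * real N * sqrt ((2 / 3) ^ card P)"
proof -
  define k m where "k = card P" and "m = \<Prod>P"
  have P3: "p \<ge> 3" if "p \<in> P" for p
    using P that odd_prime_ge_3 by (simp add: minus_one_roots_def)
  have finP: "finite P" using P by (simp add: minus_one_roots_def)
  have P0: "0 \<notin> P" using P3[of 0] by auto
  have prod_pos: "\<Prod>T > 0" if "T \<subseteq> P" for T
    using that P0 by (intro prod_pos) (metis gr0I subsetD)
  have m: "m > 0" by (simp add: m_def prod_pos)
  have finB: "finite B" using B by (rule finite_subset) auto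
  define D where "D = {z\<in>B \<times> B. fst z \<noteq> snd z}"
  have split: "B \<times> B = (\<lambda>x. (x, x)) ` B \<union> D" by (auto simp: D_def)
  have finD: "finite D" using finB by (simp add: D_def)
  define c where "c z = card {S\<in>Pow P. fst z - snd z \<in> root_lattice r P S}" for z
  have c_le: "c z \<le> 2 ^ k" for z
    unfolding c_def k_def card_Pow[OF finP, symmetric] using finP by (intro card_mono) auto

  have "2 ^ k * (card B)\<^sup>2 = (\<Sum>S\<in>Pow P. (card B)\<^sup>2)"
    by (simp add: card_Pow finP k_def)
  also have "\<dots> \<le> (\<Sum>S\<in>Pow P. m * card {z\<in>B \<times> B. fst z - snd z \<in> root_lattice r P S})"
    unfolding m_def by (intro sum_mono card_squared_le_lattice_pairs finB finP P0)
  also have "\<dots> = m * (\<Sum>z\<in>B \<times> B. c z)"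
    unfolding sum_distrib_left[symmetric] c_def
    by (subst sum_card_swap) (use finB finP in auto)
  also have "(\<Sum>z\<in>B \<times> B. c z) = (\<Sum>z\<in>(\<lambda>x. (x, x)) ` B. c z) + (\<Sum>z\<in>D. c z)"
    unfolding split by (rule sum.union_disjoint) (use finB finD in \<open>auto simp: D_def\<close>)
  also have "(\<Sum>z\<in>(\<lambda>x. (x, x)) ` B. c z) \<le> card B * 2 ^ k"
  proof -
    have "(\<Sum>z\<in>(\<lambda>x. (x, x)) ` B. c z) \<le> card ((\<lambda>x. (x, x)) ` B) * 2 ^ k"
      using sum_bounded_above[of "(\<lambda>x. (x, x)) ` B" c "2 ^ k"] c_le by simp
    also have "\<dots> \<le> card B * 2 ^ k" by (intro mult_right_mono card_image_le finB) auto
    finally show ?thesis .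
  qed
  also have "(\<Sum>z\<in>D. c z) \<le> (\<Sum>z\<in>D. card {T\<in>Pow P. int (m * \<Prod>T) dvd norm_sq (fst z - snd z)})"
    unfolding c_def m_def by (intro sum_mono card_lattices_containing_le P)
  also have "\<dots> = (\<Sum>T\<in>Pow P. card {z\<in>D. int (m * \<Prod>T) dvd norm_sq (fst z - snd z)})"
    by (rule sum_card_swap) (use finD finP in auto)
  also have "\<dots> \<le> (\<Sum>T\<in>Pow P. 2 * (2 * N\<^sup>2 div (m * \<Prod>T)))"
  proof (rule sum_mono)
    fix T assume "T \<in> Pow P"
    then have "m * \<Prod>T > 0" using m prod_pos by auto
    from card_pairs_norm_dvd_le[OF B nd this]
    show "card {z\<in>D. int (m * \<Prod>T) dvd norm_sq (fst z - snd z)} \<le> 2 * (2 * N\<^sup>2 div (m * \<Prod>T))"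
      by (simp add: D_def conj_assoc)
  qed
  finally have nat_bound: "2 ^ k * (card B)\<^sup>2 \<le> m * (card B * 2 ^ k + (\<Sum>T\<in>Pow P. 2 * (2 * N\<^sup>2 div (m * \<Prod>T))))"
    by simp
  have "real (\<Sum>T\<in>Pow P. 2 * (2 * N\<^sup>2 div (m * \<Prod>T))) \<le> (\<Sum>T\<in>Pow P. 4 * (real N)\<^sup>2 / real m * (1 / real (\<Prod>T)))"
    unfolding of_nat_sum
  proof (rule sum_mono)
    fix T
    show "real (2 * (2 * N\<^sup>2 div (m * \<Prod>T))) \<le> 4 * (real N)\<^sup>2 / real m * (1 / real (\<Prod>T))"
      using of_nat_div_le_of_nat[where 'a = real, of "2 * N\<^sup>2" "m * \<Prod>T"] by simp
  qed
  also have "\<dots> = 4 * (real N)\<^sup>2 / real m * (\<Sum>T\<in>Pow P. 1 / real (\<Prod>T))"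
    by (simp only: sum_distrib_left)
  also have "\<dots> \<le> 4 * (real N)\<^sup>2 / real m * (4 / 3) ^ k"
    unfolding k_def by (intro mult_left_mono sum_inverse_subset_prods_le finP P3) auto
  finally have off: "real (\<Sum>T\<in>Pow P. 2 * (2 * N\<^sup>2 div (m * \<Prod>T))) \<le> 4 * (real N)\<^sup>2 / real m * (4 / 3) ^ k" .
  have "2 ^ k * (real (card B))\<^sup>2 \<le> real m * (real (card B) * 2 ^ k + real (\<Sum>T\<in>Pow P. 2 * (2 * N\<^sup>2 div (m * \<Prod>T))))"
    using nat_bound[THEN of_nat_mono[where 'a = real]] by simp
  also have "\<dots> \<le> real m * (real (card B) * 2 ^ k + 4 * (real N)\<^sup>2 / real m * (4 / 3) ^ k)"
    using off by (intro mult_left_mono add_left_mono) auto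
  also have "\<dots> = 2 ^ k * (real m * real (card B) + 4 * (real N)\<^sup>2 * (2 / 3) ^ k)"
  proof -
    have "(4 / 3 :: real) ^ k = 2 ^ k * (2 / 3) ^ k" by (simp flip: power_mult_distrib)
    then show ?thesis using m by (simp add: algebra_simps)
  qed
  finally have "(real (card B))\<^sup>2 \<le> real m * real (card B) + 4 * (real N)\<^sup>2 * (2 / 3) ^ k"
    by simp
  also have "4 * (real N)\<^sup>2 * (2 / 3) ^ k = (2 * real N * sqrt ((2 / 3) ^ k))\<^sup>2"
    by (simp add: power_mult_distrib)
  finally show ?thesis
    unfolding k_def m_def by (rule le_sum_of_quadratic_le) (auto simp del: of_nat_prod)
qed

section \<open>The bound for subsets of the grid\<close>

lemma ex_small_primes_with_roots:
  "\<exists>r P. minus_one_roots r P \<and> card P = k \<and> (\<forall>p\<in>P. p \<le> (24 * k) ^ 25)"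
proof (cases "k = 0")
  case True
  show ?thesis
    by (intro exI[of _ "\<lambda>_. 0"] exI[of _ "{}"]) (use True in \<open>auto simp: minus_one_roots_def\<close>)
next
  case False
  define Y where "Y = 24 * k"
  define Q where "Q = primes_dividing_squares_plus_one (Y ^ 12)"
  have Y: "Y \<ge> 2" using False by (simp add: Y_def)
  have "k \<le> card Q"
    using many_primes_dividing_squares_plus_one[OF Y] by (simp add: Q_def Y_def)
  then obtain P where P: "P \<subseteq> Q" "card P = k" "finite P"
    by (metis obtain_subset_with_card_n)
  have "\<forall>p\<in>P. \<exists>s. int p dvd s\<^sup>2 + 1"
  proof
    fix p assume "p \<in> P"
    then obtain n where "p dvd n\<^sup>2 + 1"
      using P by (auto simp: Q_def primes_dividing_squares_plus_one_def)
    then have "int p dvd int (n\<^sup>2 + 1)" by (simp only: int_dvd_int_iff)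
    then have "int p dvd (int n)\<^sup>2 + 1" by (simp add: add.commute)
    then show "\<exists>s. int p dvd s\<^sup>2 + 1" by blast
  qed
  then obtain r where r: "\<forall>p\<in>P. int p dvd (r p)\<^sup>2 + 1" by metis
  show ?thesis
  proof (intro exI conjI ballI)
    show "minus_one_roots r P"
      using P r by (auto simp: minus_one_roots_def Q_def primes_dividing_squares_plus_one_def)
    fix p assume "p \<in> P"
    then have "p \<in> primes_dividing_squares_plus_one (Y ^ 12)" using P by (auto simp: Q_def)
    then have "p \<le> (Y ^ 12)\<^sup>2 + 1" by (rule primes_dividing_squares_plus_one_le)
    also have "\<dots> = Y ^ 24 + 1" by (simp flip: power_mult)
    also have "\<dots> \<le> Y ^ 24 + Y ^ 24" using Y by simp
    also have "\<dots> = 2 * Y ^ 24" by simp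
    also have "\<dots> \<le> Y * Y ^ 24" using Y by (intro mult_right_mono) auto
    also have "\<dots> = Y ^ 25" using power_Suc[of Y 24] by simp
    finally show "p \<le> (24 * k) ^ 25" by (simp only: Y_def)
  qed (use P in simp)
qed

lemma g_le_of_minus_one_roots:
  assumes "minus_one_roots r P"
  shows "real (g N) \<le> real (\<Prod>P) + 2 * real N * sqrt ((2 / 3) ^ card P)"
proof -
  obtain A where A: "A \<subseteq> grid N" "no_distance_twice A" "g N = card A"
    using g_attained[of N] by auto
  define e where "e d = (real_of_int (fst d), real_of_int (snd d))" for d
  have inj: "inj e" by (rule injI) (simp add: e_def prod_eq_iff)
  define B where "B = {d \<in> {1..int N} \<times> {1..int N}. e d \<in> A}"
  have "A \<subseteq> e ` B"
  proof
    fix x assume x: "x \<in> A"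
    then obtain m n where mn: "x = (real m, real n)" "m \<in> {1..N}" "n \<in> {1..N}"
      using A(1) by (auto simp: grid_def)
    then have "x = e (int m, int n)" by (simp add: e_def)
    moreover have "(int m, int n) \<in> B" using x mn calculation by (simp add: B_def)
    ultimately show "x \<in> e ` B" by (rule image_eqI)
  qed
  moreover have "e ` B \<subseteq> A" by (auto simp: B_def)
  ultimately have eB: "e ` B = A" by (intro equalityI)
  have dist_e: "dist (e p) (e q) = sqrt (real_of_int (norm_sq (p - q)))" for p q
    by (simp add: e_def dist_Pair_Pair norm_sq_def dist_real_def)
  have "norm_determines_pair B"
    unfolding norm_determines_pair_def
  proof (intro ballI impI)
    fix p q u v
    assume mem: "p \<in> B" "q \<in> B" "u \<in> B" "v \<in> B" and ne: "p \<noteq> q" "u \<noteq> v"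
      and eq: "norm_sq (p - q) = norm_sq (u - v)"
    have "e p \<in> A" "e q \<in> A" "e u \<in> A" "e v \<in> A" using mem by (auto simp: B_def)
    moreover have "e p \<noteq> e q" "e u \<noteq> e v" using ne inj by (auto dest: injD)
    moreover have "dist (e p) (e q) = dist (e u) (e v)" by (simp add: dist_e eq)
    ultimately have "{e p, e q} = {e u, e v}"
      using A(2)[unfolded no_distance_twice_def, rule_format, of "e p" "e q" "e u" "e v"] by metis
    then have "e ` {p, q} = e ` {u, v}" by simp
    then show "{p, q} = {u, v}" using inj by (simp only: inj_image_eq_iff)
  qed
  moreover have "B \<subseteq> {1..int N} \<times> {1..int N}" by (auto simp: B_def)
  moreover have "g N = card B"
    using A(3) eB card_image[OF inj_on_subset[OF inj subset_UNIV], of B] by simp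
  ultimately show ?thesis
    using card_le_of_norm_determines_pair[of B N r P] assms by (simp only:)
qed

text \<open>
  With \<open>L = ln N\<close> and \<open>l = ln L\<close>, the number \<open>k = \<lfloor>L / (50 * l)\<rfloor>\<close> of primes satisfies \<open>24 * k \<le> L\<close>, so the
  product of \<open>k\<close> primes up to \<open>(24 * k) ^ 25\<close> is at most \<open>L ^ (25 * k) \<le> exp (L / 2)\<close>, the square root
  of \<open>N\<close>. Since \<open>2 / 3 \<le> exp (-1 / 3)\<close>, the other term decays like \<open>exp (-k / 6)\<close>, which is where the
  constant \<open>1 / 300\<close> comes from.
\<close>
lemma g_le_of_large:
  fixes N :: nat
  assumes N: "N \<ge> 3" and l1: "ln (ln (real N)) \<ge> 1"
  shows "real (g N) \<le> 7 * (real N * exp (- (1 / 300) * (ln (real N) / ln (ln (real N)))))"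
proof -
  define L l where "L = ln (real N)" and "l = ln L"
  define k where "k = nat \<lfloor>L / (50 * l)\<rfloor>"
  define E where "E = exp (- (1 / 300) * (L / l))"
  have l: "l \<ge> 1" using l1 by (simp add: l_def L_def)
  have L: "L > 0" using N by (simp add: L_def)
  have NL: "real N = exp L" using N by (simp add: L_def)
  have k_le: "real k \<le> L / (50 * l)"
    unfolding k_def using L l by (intro of_nat_floor) auto
  have k_ge: "real k \<ge> L / (50 * l) - 1"
    unfolding k_def by linarith
  obtain r P where P: "minus_one_roots r P" "card P = k" "\<And>p. p \<in> P \<Longrightarrow> p \<le> (24 * k) ^ 25"
    using ex_small_primes_with_roots[of k] by blast

  have "real (\<Prod>P) \<le> exp (L / 2)"
  proof (cases "k = 0")
    case True
    then have "P = {}" using P by (auto simp: minus_one_roots_def)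
    then show ?thesis using L by simp
  next
    case False
    have "L / (50 * l) \<le> L / 50" using l L by (intro divide_left_mono) auto
    then have kL: "real (24 * k) \<le> L" using k_le L by simp
    have "real (\<Prod>P) \<le> (\<Prod>p\<in>P. real (24 * k) ^ 25)"
      unfolding of_nat_prod
    proof (intro prod_mono conjI)
      fix p assume "p \<in> P"
      from P(3)[OF this] have "real p \<le> real ((24 * k) ^ 25)" by (simp only: of_nat_le_iff)
      then show "real p \<le> real (24 * k) ^ 25" by simp
    qed auto
    also have "\<dots> = real (24 * k) ^ (25 * k)" by (simp only: prod_constant P(2) power_mult)
    also have "\<dots> \<le> L ^ (25 * k)" using kL by (intro power_mono) auto
    also have "\<dots> = exp (real (25 * k) * l)" using L by (simp only: exp_of_nat_mult l_def exp_ln)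
    also have "\<dots> \<le> exp (L / 2)"
      using mult_right_mono[OF k_le, of l] l by simp
    finally show ?thesis .
  qed
  also have "exp (L / 2) = real N * exp (- (L / 2))"
    unfolding NL by (simp flip: exp_add)
  also have "\<dots> \<le> real N * E"
  proof -
    have "L / l \<le> L / 1" using l L by (intro divide_left_mono) auto
    then show ?thesis unfolding E_def using L by (intro mult_left_mono) auto
  qed
  finally have 1: "real (\<Prod>P) \<le> real N * E" .

  have "2 / 3 \<le> exp (- (1 / 3) :: real)" using exp_ge_add_one_self[of "- (1 / 3)"] by simp
  then have "(2 / 3) ^ k \<le> exp (- (1 / 3) :: real) ^ k" by (intro power_mono) auto
  also have "\<dots> = (exp (- (real k / 6)))\<^sup>2" by (simp flip: exp_of_nat_mult)
  finally have "sqrt ((2 / 3) ^ k) \<le> exp (- (real k / 6))" by (intro real_le_lsqrt) auto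
  also have "\<dots> \<le> exp (- (1 / 300) * (L / l) + 1)"
    using k_ge by simp
  also have "\<dots> = E * exp 1" by (simp only: E_def exp_add)
  also have "\<dots> \<le> E * 3" by (intro mult_left_mono exp_le) (simp add: E_def)
  finally have 2: "sqrt ((2 / 3) ^ k) \<le> E * 3" .

  have "real (g N) \<le> real (\<Prod>P) + 2 * real N * sqrt ((2 / 3) ^ k)"
    using g_le_of_minus_one_roots[OF P(1), of N] by (simp only: P(2))
  also have "\<dots> \<le> real N * E + 2 * real N * (E * 3)"
    using 1 2 by (intro add_mono mult_left_mono) auto
  also have "\<dots> = 7 * (real N * E)" by simp
  finally show ?thesis by (simp only: E_def L_def l_def)
qed

text \<open>
  The condition \<open>ln (ln N) \<ge> 1\<close> of the previous lemma excludes only finitely many \<open>N\<close>, which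
  are absorbed into the constant.
\<close>
theorem theorem1p3:
  shows "\<exists>c::real. c > 0 \<and>
           (\<exists>C::real. C > 0 \<and>
             (\<forall>N::nat. N \<ge> 3 \<longrightarrow>
               real (g N) \<le> C * (real N * exp (- c * (ln (real N) / ln (ln (real N)))))))"
proof -
  define h :: "nat \<Rightarrow> real"
    where "h N = real N * exp (- (1 / 300) * (ln (real N) / ln (ln (real N))))" for N
  define S where "S = {N::nat. N \<ge> 3 \<and> ln (ln (real N)) < 1}"
  define C where "C = (\<Sum>N\<in>S. real (g N) / h N)"
  have hpos: "h N > 0" if "N \<ge> 3" for N using that by (simp add: h_def)
  have "S \<subseteq> {..nat \<lceil>exp (exp 1 :: real)\<rceil>}"
  proof
    fix N assume N: "N \<in> S"
    then have "1 < real N" by (simp add: S_def)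
    then have "0 < ln (real N)" by simp
    then have "ln (real N) < exp 1"
      using N by (subst ln_less_cancel_iff[symmetric]) (auto simp: S_def)
    then have "real N < exp (exp 1)"
      using \<open>1 < real N\<close> by (subst ln_less_cancel_iff[symmetric]) auto
    then show "N \<in> {..nat \<lceil>exp (exp 1 :: real)\<rceil>}" by simp linarith
  qed
  then have finS: "finite S" by (rule finite_subset) simp
  have C0: "C \<ge> 0"
    unfolding C_def by (intro sum_nonneg divide_nonneg_pos hpos) (auto simp: S_def)
  have "real (g N) \<le> (C + 7) * h N" if N: "N \<ge> 3" for N
  proof (cases "N \<in> S")
    case True
    have "real (g N) / h N \<le> C"
      unfolding C_def
      by (rule member_le_sum[OF True]) (use finS hpos in \<open>auto simp: S_def intro!: divide_nonneg_pos\<close>)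
    then have "real (g N) \<le> C * h N" using hpos[OF N] by (simp add: field_simps)
    also have "\<dots> \<le> (C + 7) * h N" using hpos[OF N] by (intro mult_right_mono) auto
    finally show ?thesis .
  next
    case False
    then have "real (g N) \<le> 7 * h N"
      using N g_le_of_large[of N] by (simp add: S_def h_def)
    also have "\<dots> \<le> (C + 7) * h N" using hpos[OF N] C0 by (intro mult_right_mono) auto
    finally show ?thesis .
  qed
  then show ?thesis
    using C0 unfolding h_def by (intro exI[of _ "1 / 300"] conjI exI[of _ "C + 7"]) auto
qed

end
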